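(* Let $(S,\cdot)$ be a semigroup and let $A\subseteq S$. (1) $d_t(A)=1$ if and only if $A$ is thick. (2) If $S$ is left amenable, then $d^*(A)=1$ if and only if $A$ is thick. (3) If $S$ satisfies the Strong F\o lner Condition, then $d(A)=1$ if and only if $A$ is thick.
   Context: ${\mathcal P}_f(S)$ is the set of finite nonempty subsets of $S$. $A$ is thick if for every $F\in{\mathcal P}_f(S)$ there is $x\in S$ with $Fx\subseteq A$. $As^{-1}=\{y\in S:ys\in A\}$. $d_t(A)=\sup\{\alpha\in[0,1]:$ for every $F\in{\mathcal P}_f(S)$ there is $s\in S$ with $|F\cap As^{-1}|\ge\alpha|F|\}$. A mean on $S$ is a continuous linear functional $\mu$ on $l_\infty(S)$ with $\|\mu\|=1$ and $\mu\ge0$ on nonnegative functions; it is left invariant if $\mu(g\circ\lambda_s)=\mu(g)$ for all $s\in S$, where $\lambda_s(y)=sy$; $S$ is left amenable if a left invariant mean exists, and then $d^*(A)=\sup\{\lambda(\chi_A):\lambda$ a left invariant mean$\}$. $S$ satisfies the Strong F\o lner Condition if for every $H\in{\mathcal P}_f(S)$, $\epsilon>0$ there is $K\in{\mathcal P}_f(S)$ with $|K\setminus sK|<\epsilon|K|$ for all $s\in H$; then $d(A)$ is the supremum of $\alpha\in[0,1]$ such that for every $H\in{\mathcal P}_f(S)$, $\epsilon>0$ there is $K\in{\mathcal P}_f(S)$ with $|K\setminus sK|<\epsilon|K|$ for all $s\in H$ and $|A\cap K|\ge\alpha|K|$. *)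

theory Defs
  imports "HOL-Analysis.Analysis" "HOL-Probability.Discrete_Topology"
begin

text \<open>
  The semigroup S is a type of class \<open>semigroup_mult\<close>; in particular S is nonempty.
\<close>

definition thick :: "'a::semigroup_mult set \<Rightarrow> bool" where
  "thick A \<longleftrightarrow> (\<forall>F. finite F \<and> F \<noteq> {} \<longrightarrow> (\<exists>x. (\<lambda>y. y * x) ` F \<subseteq> A))"

definition right_quotient :: "'a::semigroup_mult set \<Rightarrow> 'a \<Rightarrow> 'a set" where
  "right_quotient A s = {y. y * s \<in> A}"

definition d_t :: "'a::semigroup_mult set \<Rightarrow> real" where
  "d_t A = Sup {\<alpha>\<in>{0..1}. \<forall>F. finite F \<and> F \<noteq> {} \<longrightarrow>
     (\<exists>s. real (card (F \<inter> right_quotient A s)) \<ge> \<alpha> * real (card F))}"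

text \<open>
  The Banach space \<open>l\<^sub>\<infinity>(S)\<close> of bounded real functions on S with the supremum norm: every
  function on a discrete space is continuous, so the library's space of bounded continuous
  functions on the discrete copy of S consists of all bounded functions on S.
\<close>

type_synonym 'a linf = "'a discrete \<Rightarrow>\<^sub>C real"

setup_lifting type_definition_bcontfun

lift_definition linf_indicator :: "'a set \<Rightarrow> 'a linf" is
  "\<lambda>A x. indicator A (of_discrete x)"
proof -
  fix A :: "'a set"
  have "bounded (range (\<lambda>x. indicator A (of_discrete x) :: real))"
    by (rule boundedI[of _ 1]) (auto simp: indicator_def)
  then show "(\<lambda>x. indicator A (of_discrete x) :: real) \<in> bcontfun"
    by (simp add: bcontfun_def continuous_on_open_invariant open_discrete)
qed

text \<open>The function \<open>g \<circ> \<lambda>\<^sub>s\<close>, where \<open>\<lambda>\<^sub>s(y) = sy\<close>.\<close>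

lift_definition left_translate :: "'a::semigroup_mult \<Rightarrow> 'a linf \<Rightarrow> 'a linf" is
  "\<lambda>s g y. g (discrete (s * of_discrete y))"
proof -
  fix s :: 'a and g :: "'a discrete \<Rightarrow> real"
  assume "g \<in> bcontfun"
  then have "bounded (range g)"
    by (simp add: bcontfun_def)
  then have "bounded (range (\<lambda>y. g (discrete (s * of_discrete y))))"
    by (rule bounded_subset) auto
  then show "(\<lambda>y. g (discrete (s * of_discrete y))) \<in> bcontfun"
    by (simp add: bcontfun_def continuous_on_open_invariant open_discrete)
qed

definition mean :: "('a linf \<Rightarrow>\<^sub>L real) \<Rightarrow> bool" where
  "mean \<mu> \<longleftrightarrow> norm \<mu> = 1 \<and> (\<forall>g. (\<forall>x. 0 \<le> apply_bcontfun g x) \<longrightarrow> 0 \<le> blinfun_apply \<mu> g)"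

definition left_invariant_mean :: "('a::semigroup_mult linf \<Rightarrow>\<^sub>L real) \<Rightarrow> bool" where
  "left_invariant_mean \<mu> \<longleftrightarrow> mean \<mu> \<and>
     (\<forall>s g. blinfun_apply \<mu> (left_translate s g) = blinfun_apply \<mu> g)"

definition left_amenable :: "'a::semigroup_mult itself \<Rightarrow> bool" where
  "left_amenable _ \<longleftrightarrow> (\<exists>\<mu> :: 'a linf \<Rightarrow>\<^sub>L real. left_invariant_mean \<mu>)"

definition d_star :: "'a::semigroup_mult set \<Rightarrow> real" where
  "d_star A = Sup {blinfun_apply \<mu> (linf_indicator A) |\<mu>. left_invariant_mean \<mu>}"

definition almost_invariant :: "'a::semigroup_mult set \<Rightarrow> real \<Rightarrow> 'a set \<Rightarrow> bool" where
  "almost_invariant H \<epsilon> K \<longleftrightarrow>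
     (\<forall>s\<in>H. real (card (K - (\<lambda>k. s * k) ` K)) < \<epsilon> * real (card K))"

definition strong_Folner :: "'a::semigroup_mult itself \<Rightarrow> bool" where
  "strong_Folner _ \<longleftrightarrow> (\<forall>H :: 'a set. \<forall>\<epsilon>>0. finite H \<and> H \<noteq> {} \<longrightarrow>
     (\<exists>K. finite K \<and> K \<noteq> {} \<and> almost_invariant H \<epsilon> K))"

definition d_Folner :: "'a::semigroup_mult set \<Rightarrow> real" where
  "d_Folner A = Sup {\<alpha>\<in>{0..1}. \<forall>H. \<forall>\<epsilon>>0. finite H \<and> H \<noteq> {} \<longrightarrow>
     (\<exists>K. finite K \<and> K \<noteq> {} \<and> almost_invariant H \<epsilon> K \<and>
        real (card (A \<inter> K)) \<ge> \<alpha> * real (card K))}"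

end

theory Submission
  imports Defs
begin

text \<open>
  If a density is 1, then each of the finitely many conditions \<open>t * x \<in> A\<close>, \<open>t \<in> F\<close>, fails for
  a proportion of the \<open>x\<close> smaller than \<open>1 / |F|\<close>, so some \<open>x\<close> satisfies all of them.

  Conversely let \<open>A\<close> be thick. By compactness there is a mean \<open>\<nu>\<close> giving value 1 to every
  \<open>\<chi>\<^sub>A \<circ> \<lambda>\<^sub>s\<close>, and convolving it with a left invariant mean yields a left invariant mean with value
  1 at \<open>\<chi>\<^sub>A\<close>. Under the Strong Folner Condition, \<open>S\<close> is left cancellative modulo the relation
  \<open>\<exists>z. a * z = b * z\<close>. Hence a finite almost invariant \<open>K\<close> has a right translate \<open>K v \<subseteq> A\<close> on which
  all left translations are injective, and a level set of \<open>y \<mapsto> |{k \<in> K. k * v = y}|\<close> is again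
  almost invariant.
\<close>

section \<open>Suprema equal to one and the density \<open>d_t\<close>\<close>

lemma Sup_eq_one_approx:
  fixes D :: "real set"
  assumes "Sup D = 1" "D \<noteq> {}" "bdd_above D" "\<delta> > 0"
  obtains \<alpha> where "\<alpha> \<in> D" "1 - \<delta> < \<alpha>"
  using assms less_cSup_iff[of D "1 - \<delta>"] by auto

lemma Sup_unit_eq_one:
  fixes D :: "real set"
  assumes "D \<subseteq> {..1}" "1 \<in> D"
  shows "Sup D = 1"
  by (rule cSup_eq_maximum) (use assms in auto)

lemma d_t_eq_one_iff: "d_t A = 1 \<longleftrightarrow> thick A"
proof -
  define D where "D = {\<alpha>\<in>{0..1}. \<forall>F. finite F \<and> F \<noteq> {} \<longrightarrow>
     (\<exists>s. real (card (F \<inter> right_quotient A s)) \<ge> \<alpha> * real (card F))}"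
  have d: "d_t A = Sup D"
    unfolding d_t_def D_def ..
  show ?thesis
  proof
    assume "thick A"
    have "\<exists>s. real (card (F \<inter> right_quotient A s)) \<ge> 1 * real (card F)"
      if F: "finite F \<and> F \<noteq> {}" for F
    proof -
      obtain s where "(\<lambda>y. y * s) ` F \<subseteq> A"
        using \<open>thick A\<close> F unfolding thick_def by blast
      then have "F \<inter> right_quotient A s = F"
        unfolding right_quotient_def by blast
      then show ?thesis
        by (intro exI[of _ s]) simp
    qed
    then have "1 \<in> D"
      unfolding D_def by auto
    then show "d_t A = 1"
      unfolding d by (intro Sup_unit_eq_one) (auto simp: D_def)
  next
    assume 1: "d_t A = 1"
    \<comment> \<open>A real \<open>Sup\<close> is informative only for a nonempty set bounded
      above; here 0 always lies in \<open>D\<close>.\<close>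
    have ne: "D \<noteq> {}" "bdd_above D"
      unfolding D_def by (auto intro!: exI[of _ 0] bdd_aboveI[of _ 1])
    show "thick A"
      unfolding thick_def
    proof (intro allI impI)
      fix F :: "'a set"
      assume F: "finite F \<and> F \<noteq> {}"
      then have cF: "card F > 0"
        by auto
      \<comment> \<open>With this margin the count exceeds \<open>card F - 1\<close>, so as an
        integer it is at least \<open>card F\<close>.\<close>
      obtain \<alpha> where \<alpha>: "\<alpha> \<in> D" "1 - 1 / real (card F) < \<alpha>"
        using Sup_eq_one_approx[OF 1[unfolded d] ne, of "1 / real (card F)"] cF by auto
      then obtain s where s: "real (card (F \<inter> right_quotient A s)) \<ge> \<alpha> * real (card F)"
        using F unfolding D_def by blast
      have "real (card F) - 1 < \<alpha> * real (card F)"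
        using \<alpha>(2) cF by (simp add: field_simps)
      with s have "card F \<le> card (F \<inter> right_quotient A s)"
        by linarith
      then have "F \<inter> right_quotient A s = F"
        using F by (intro card_seteq) auto
      then show "\<exists>x. (\<lambda>y. y * x) ` F \<subseteq> A"
        unfolding right_quotient_def by blast
    qed
  qed
qed

section \<open>Means\<close>

lemma apply_left_translate [simp]:
  "apply_bcontfun (left_translate s g) x = apply_bcontfun g (discrete (s * of_discrete x))"
  by (simp add: left_translate.rep_eq)

lemma apply_linf_indicator [simp]:
  "apply_bcontfun (linf_indicator A) x = indicator A (of_discrete x)"
  by (simp add: linf_indicator.rep_eq)

lemma bcontfun_sum_apply:
  "apply_bcontfun (\<Sum>i\<in>I. f i) x = (\<Sum>i\<in>I. apply_bcontfun (f i) x)"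
  by (induction I rule: infinite_finite_induct) auto

lemma bounded_imp_bcontfun_discrete:
  fixes f :: "'a discrete \<Rightarrow> real"
  assumes "\<And>x. \<bar>f x\<bar> \<le> b"
  shows "f \<in> bcontfun"
  by (rule bcontfun_normI[of _ b])
     (use assms in \<open>auto simp: continuous_on_open_invariant open_discrete\<close>)

text \<open>Boundedness is not built in: as a set of plain functions, these form a closed subset of a
  product of compact intervals.\<close>

definition pre_mean :: "('a linf \<Rightarrow> real) \<Rightarrow> bool" where
  "pre_mean \<nu> \<longleftrightarrow> (\<forall>g h. \<nu> (g + h) = \<nu> g + \<nu> h) \<and> (\<forall>c g. \<nu> (c *\<^sub>R g) = c * \<nu> g) \<and>
     (\<forall>g. (\<forall>x. 0 \<le> apply_bcontfun g x) \<longrightarrow> 0 \<le> \<nu> g) \<and> \<nu> (const_bcontfun 1) = 1"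

lemma pre_mean_linear: "pre_mean \<nu> \<Longrightarrow> linear \<nu>"
  unfolding pre_mean_def by (intro linearI) auto

lemma pre_mean_mono:
  assumes "pre_mean \<nu>" "\<And>x. apply_bcontfun g x \<le> apply_bcontfun h x"
  shows "\<nu> g \<le> \<nu> h"
proof -
  have "0 \<le> \<nu> (h - g)"
    using assms unfolding pre_mean_def by auto
  then show ?thesis
    by (simp add: linear_diff[OF pre_mean_linear[OF assms(1)]])
qed

lemma pre_mean_const: "pre_mean \<nu> \<Longrightarrow> \<nu> (const_bcontfun c) = c"
proof -
  assume a: "pre_mean \<nu>"
  have "const_bcontfun c = c *\<^sub>R const_bcontfun (1::real)"
    by (rule bcontfun_eqI) auto
  then show ?thesis
    using a unfolding pre_mean_def by (metis mult.right_neutral)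
qed

text \<open>Trapping \<open>g\<close> between the constants \<open>- norm g\<close> and
  \<open>norm g\<close> recovers the boundedness left out of \<open>pre_mean\<close>.\<close>

lemma pre_mean_abs_le:
  assumes "pre_mean \<nu>"
  shows "\<bar>\<nu> g\<bar> \<le> norm g"
proof -
  have b: "\<bar>apply_bcontfun g x\<bar> \<le> norm g" for x
    using norm_bounded[of g x] by simp
  have "\<nu> g \<le> \<nu> (const_bcontfun (norm g))" "\<nu> (const_bcontfun (- norm g)) \<le> \<nu> g"
    by (intro pre_mean_mono[OF assms]; use b abs_le_iff in \<open>force simp: abs_le_iff minus_le_iff\<close>)+
  then show ?thesis
    by (simp add: pre_mean_const[OF assms])
qed

text \<open>A positive functional has norm equal to its value at the constant 1, so the two
  normalizations agree.\<close>

lemma mean_iff_pre_mean: "mean \<mu> \<longleftrightarrow> pre_mean (blinfun_apply \<mu>)"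
proof
  let ?one = "const_bcontfun 1 :: 'a linf"
  assume m: "mean \<mu>"
  then have pos: "\<And>g. (\<And>x. 0 \<le> apply_bcontfun g x) \<Longrightarrow> 0 \<le> blinfun_apply \<mu> g"
    unfolding mean_def by auto
  have bound: "\<bar>blinfun_apply \<mu> g\<bar> \<le> blinfun_apply \<mu> ?one * norm g" for g
  proof -
    have b: "\<bar>apply_bcontfun g x\<bar> \<le> norm g" for x
      using norm_bounded[of g x] by simp
    have "- norm g \<le> apply_bcontfun g x" "apply_bcontfun g x \<le> norm g" for x
      using b[of x] by auto
    then have "0 \<le> blinfun_apply \<mu> (norm g *\<^sub>R ?one - g)" "0 \<le> blinfun_apply \<mu> (norm g *\<^sub>R ?one + g)"
      by (intro pos; simp add: add.commute[of "norm g"] flip: diff_le_eq minus_le_iff; simp add: minus_le_iff)+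
    then show ?thesis
      by (simp add: blinfun.bilinear_simps abs_le_iff mult.commute)
  qed
  have "norm \<mu> \<le> blinfun_apply \<mu> ?one"
    by (rule norm_blinfun_bound) (use pos[of ?one] bound in auto)
  moreover have "blinfun_apply \<mu> ?one \<le> norm \<mu>"
  proof -
    have "norm ?one \<le> 1"
      by (rule norm_bound) simp
    then have "norm \<mu> * norm ?one \<le> norm \<mu>"
      by (simp add: mult_left_le)
    then show ?thesis
      using norm_blinfun[of \<mu> ?one] by simp
  qed
  ultimately show "pre_mean (blinfun_apply \<mu>)"
    using m unfolding pre_mean_def mean_def by (simp add: blinfun.bilinear_simps)
next
  assume p: "pre_mean (blinfun_apply \<mu>)"
  have "norm \<mu> \<le> 1"
    by (rule norm_blinfun_bound) (use pre_mean_abs_le[OF p] in auto)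
  moreover have "1 \<le> norm \<mu>"
  proof -
    have "1 = norm (blinfun_apply \<mu> (const_bcontfun 1))"
      using p unfolding pre_mean_def by simp
    also have "\<dots> \<le> norm \<mu> * norm (const_bcontfun 1 :: 'a linf)"
      by (rule norm_blinfun)
    also have "\<dots> \<le> norm \<mu> * 1"
      by (intro mult_left_mono norm_bound) auto
    finally show ?thesis
      by simp
  qed
  ultimately show "mean \<mu>"
    using p unfolding pre_mean_def mean_def by auto
qed

lemma pre_mean_obtain_blinfun:
  assumes "pre_mean \<nu>"
  obtains \<mu> where "blinfun_apply \<mu> = \<nu>"
proof
  have "bounded_linear \<nu>"
    using pre_mean_linear[OF assms] pre_mean_abs_le[OF assms]
    by (intro bounded_linear_intro[where K = 1])
       (auto simp: linear_add linear_scale)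
  then show "blinfun_apply (Blinfun \<nu>) = \<nu>"
    by (rule bounded_linear_Blinfun_apply)
qed

text \<open>Each condition involves finitely many values of \<open>\<nu>\<close>, and evaluation at
  a fixed \<open>g\<close> is continuous in the product topology.\<close>

lemma closed_pre_mean: "closed {\<nu> :: 'a linf \<Rightarrow> real. pre_mean \<nu>}"
proof -
  have c: "continuous_on UNIV (\<lambda>\<nu>. \<nu> g)" for g :: "'a linf"
    by (rule continuous_on_product_coordinates)
  show ?thesis
    unfolding pre_mean_def
    by (intro closed_Collect_conj closed_Collect_all closed_Collect_imp closed_Collect_eq
        closed_Collect_le continuous_intros c) (auto simp: open_Collect_const)
qed

text \<open>Tychonoff's theorem makes the product of the intervals from \<open>- norm g\<close> to
  \<open>norm g\<close> compact.\<close>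

lemma compact_pre_mean: "compact {\<nu> :: 'a linf \<Rightarrow> real. pre_mean \<nu>}"
proof -
  define B where "B = (\<Pi>\<^sub>E g\<in>(UNIV :: 'a linf set). {- norm g..norm g})"
  have "compactin (product_topology (\<lambda>_. euclidean) UNIV) B"
    unfolding B_def by (subst compactin_PiE) auto
  then have "compact B"
    by (simp add: euclidean_product_topology)
  then have "compact (B \<inter> {\<nu>. pre_mean \<nu>})"
    using closed_pre_mean by (rule compact_Int_closed)
  moreover have "{\<nu>. pre_mean \<nu>} \<subseteq> B"
    using pre_mean_abs_le unfolding B_def by (auto simp: abs_le_iff minus_le_iff)
  ultimately show ?thesis
    by (simp add: Int_absorb1)
qed

lemma pre_mean_evaluation: "pre_mean (\<lambda>g. apply_bcontfun g x)"
  unfolding pre_mean_def by simp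

section \<open>Thick sets and left invariant means\<close>

text \<open>Finite intersection property: if a right translate of the finite set \<open>F\<close> by
  \<open>x\<close> lies in \<open>A\<close>, then evaluation at \<open>x\<close> takes the value 1
  on all translates by elements of \<open>F\<close>.\<close>

lemma thick_imp_pre_mean:
  assumes "thick A"
  obtains \<nu> where "pre_mean \<nu>" "\<And>s. \<nu> (left_translate s (linf_indicator A)) = 1"
proof -
  define M where "M s = {\<nu> :: 'a linf \<Rightarrow> real. \<nu> (left_translate s (linf_indicator A)) = 1}" for s
  have "{\<nu>. pre_mean \<nu>} \<inter> (\<Inter>s\<in>UNIV. M s) \<noteq> {}"
  proof (rule compact_imp_fip_image[OF compact_pre_mean])
    show "closed (M s)" for s
      unfolding M_def
      by (intro closed_Collect_eq continuous_on_product_coordinates continuous_intros)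
  next
    fix F :: "'a set"
    assume "finite F"
    then obtain x where "(\<lambda>s. s * x) ` F \<subseteq> A"
      using assms unfolding thick_def by (cases "F = {}") auto
    then have x: "\<And>s. s \<in> F \<Longrightarrow> s * x \<in> A"
      by blast
    then have "(\<lambda>g. apply_bcontfun g (discrete x)) \<in> (\<Inter>s\<in>F. M s)"
      unfolding M_def by (auto simp: discrete_inverse)
    then show "{\<nu>. pre_mean \<nu>} \<inter> (\<Inter>s\<in>F. M s) \<noteq> {}"
      using pre_mean_evaluation by blast
  qed
  then show ?thesis
    using that unfolding M_def by blast
qed

lemma left_translate_left_translate:
  "left_translate s (left_translate t g) = left_translate (t * s) g"
  by (rule bcontfun_eqI) (simp add: mult.assoc discrete_inverse)

text \<open>The new mean is the convolution \<open>g \<mapsto> \<mu> (s \<mapsto> \<nu> (g \<circ> \<lambda>\<^sub>s))\<close>, which inherits left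
  invariance from \<open>\<mu>\<close> alone.\<close>

lemma thick_imp_left_invariant_mean:
  fixes A :: "'a::semigroup_mult set" and \<mu> :: "'a linf \<Rightarrow>\<^sub>L real"
  assumes "left_invariant_mean \<mu>" "thick A"
  obtains \<mu>' where "left_invariant_mean \<mu>'" "blinfun_apply \<mu>' (linf_indicator A) = 1"
proof -
  obtain \<nu> where \<nu>: "pre_mean \<nu>" "\<And>s. \<nu> (left_translate s (linf_indicator A)) = 1"
    using thick_imp_pre_mean[OF assms(2)] by blast
  have \<mu>: "pre_mean (blinfun_apply \<mu>)"
    and inv: "\<And>s g. blinfun_apply \<mu> (left_translate s g) = blinfun_apply \<mu> g"
    using assms(1) unfolding left_invariant_mean_def mean_iff_pre_mean by auto
  define G where "G g = Bcontfun (\<lambda>x. \<nu> (left_translate (of_discrete x) g))" for g :: "'a linf"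
  have G: "apply_bcontfun (G g) x = \<nu> (left_translate (of_discrete x) g)" for g x
  proof -
    have "\<bar>\<nu> (left_translate (of_discrete y) g)\<bar> \<le> norm g" for y
    proof -
      have "norm (left_translate (of_discrete y) g) \<le> norm g"
        by (rule norm_bound) (use norm_bounded[of g] in auto)
      then show ?thesis
        using pre_mean_abs_le[OF \<nu>(1)] order_trans by blast
    qed
    then have "(\<lambda>y. \<nu> (left_translate (of_discrete y) g)) \<in> bcontfun"
      by (rule bounded_imp_bcontfun_discrete)
    then show ?thesis
      unfolding G_def by (simp add: Bcontfun_inverse)
  qed
  have lt: "left_translate s (g + h) = left_translate s g + left_translate s h"
    "left_translate s (c *\<^sub>R g) = c *\<^sub>R left_translate s g"
    "left_translate s (const_bcontfun c) = const_bcontfun c" for s c and g h :: "'a linf"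
    by (rule bcontfun_eqI; simp)+
  have "pre_mean (\<lambda>g. blinfun_apply \<mu> (G g))"
  proof -
    have "G (g + h) = G g + G h" "G (c *\<^sub>R g) = c *\<^sub>R G g" for g h c
      by (rule bcontfun_eqI; use \<nu>(1) in \<open>simp add: G lt pre_mean_def\<close>)+
    moreover have "G (const_bcontfun 1) = const_bcontfun 1"
      by (rule bcontfun_eqI) (use \<nu>(1) in \<open>simp add: G lt pre_mean_def\<close>)
    moreover have "0 \<le> apply_bcontfun (G g) x" if "\<forall>x. 0 \<le> apply_bcontfun g x" for g x
      using that \<nu>(1) unfolding G pre_mean_def by simp
    ultimately show ?thesis
      using \<mu> unfolding pre_mean_def by (simp add: blinfun.bilinear_simps)
  qed
  then obtain \<mu>' where \<mu>': "blinfun_apply \<mu>' = (\<lambda>g. blinfun_apply \<mu> (G g))" "mean \<mu>'"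
    by (metis pre_mean_obtain_blinfun mean_iff_pre_mean)
  \<comment> \<open>At \<open>x\<close> both sides are \<open>\<nu>\<close> of the translate of
    \<open>g\<close> by \<open>s * x\<close>, so invariance under \<open>\<mu>\<close> can be
    applied to \<open>G g\<close>.\<close>
  have "G (left_translate s g) = left_translate s (G g)" for s g
    by (rule bcontfun_eqI) (simp add: G left_translate_left_translate discrete_inverse)
  then have "left_invariant_mean \<mu>'"
    unfolding left_invariant_mean_def using \<mu>' inv by simp
  moreover have "G (linf_indicator A) = const_bcontfun 1"
    by (rule bcontfun_eqI) (simp add: G \<nu>(2))
  then have "blinfun_apply \<mu>' (linf_indicator A) = 1"
    using \<mu>' \<mu> by (simp add: pre_mean_const)
  ultimately show ?thesis
    using that by blast
qed

lemma d_star_eq_one_iff: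
  fixes A :: "'a::semigroup_mult set"
  assumes "left_amenable TYPE('a)"
  shows "d_star A = 1 \<longleftrightarrow> thick A"
proof -
  define D where "D = {blinfun_apply \<mu> (linf_indicator A) |\<mu>. left_invariant_mean \<mu>}"
  have d: "d_star A = Sup D"
    unfolding d_star_def D_def ..
  obtain \<mu>0 :: "'a linf \<Rightarrow>\<^sub>L real" where \<mu>0: "left_invariant_mean \<mu>0"
    using assms unfolding left_amenable_def by blast
  have le1: "D \<subseteq> {..1}"
  proof -
    have "\<nu> (linf_indicator A) \<le> 1" if "pre_mean \<nu>" for \<nu>
      using pre_mean_mono[OF that, of "linf_indicator A" "const_bcontfun 1"]
      by (simp add: pre_mean_const[OF that] indicator_def)
    then show ?thesis
      unfolding D_def left_invariant_mean_def mean_iff_pre_mean by auto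
  qed
  show ?thesis
  proof
    assume "thick A"
    then obtain \<mu> where "left_invariant_mean \<mu>" "blinfun_apply \<mu> (linf_indicator A) = 1"
      using thick_imp_left_invariant_mean[OF \<mu>0] by blast
    then have "1 \<in> D"
      unfolding D_def by force
    then show "d_star A = 1"
      unfolding d using le1 by (intro Sup_unit_eq_one)
  next
    assume 1: "d_star A = 1"
    have ne: "D \<noteq> {}"
      using \<mu>0 unfolding D_def by blast
    have bdd: "bdd_above D"
      using bdd_above_Iic le1 by (rule bdd_above_mono)
    show "thick A"
      unfolding thick_def
    proof (intro allI impI)
      fix F :: "'a set"
      assume F: "finite F \<and> F \<noteq> {}"
      then have cF: "card F > 0"
        by auto
      obtain \<alpha> where \<alpha>: "\<alpha> \<in> D" "1 - 1 / real (card F) < \<alpha>"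
        using Sup_eq_one_approx[OF 1[unfolded d] ne bdd, of "1 / real (card F)"] cF by auto
      then obtain \<mu> where \<mu>: "left_invariant_mean \<mu>" "blinfun_apply \<mu> (linf_indicator A) = \<alpha>"
        unfolding D_def by blast
      then have pm: "pre_mean (blinfun_apply \<mu>)"
        unfolding left_invariant_mean_def mean_iff_pre_mean by blast
      \<comment> \<open>At \<open>x\<close> this sum counts the \<open>t \<in> F\<close> with
        \<open>t * x \<in> A\<close>. By invariance \<open>\<mu>\<close> sends it to
        \<open>card F * \<alpha>\<close>, which exceeds \<open>card F - 1\<close>, so the count must
        reach \<open>card F\<close> somewhere.\<close>
      let ?h = "\<Sum>t\<in>F. left_translate t (linf_indicator A)"
      have h: "apply_bcontfun ?h (discrete x) = real (card {t\<in>F. t * x \<in> A})" for x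
        using F by (simp add: bcontfun_sum_apply discrete_inverse indicator_def sum.If_cases Int_def)
      show "\<exists>x. (\<lambda>y. y * x) ` F \<subseteq> A"
      proof (rule ccontr)
        assume no: "\<not> ?thesis"
        have "apply_bcontfun ?h y \<le> real (card F) - 1" for y
        proof -
          obtain x where y: "y = discrete x"
            by (metis of_discrete_inverse)
          have "{t\<in>F. t * x \<in> A} \<subset> F"
            using no by blast
          then have "card {t\<in>F. t * x \<in> A} < card F"
            using F psubset_card_mono by blast
          then show ?thesis
            unfolding y h by linarith
        qed
        then have "blinfun_apply \<mu> ?h \<le> blinfun_apply \<mu> (const_bcontfun (real (card F) - 1))"
          by (intro pre_mean_mono[OF pm]) simp
        moreover have "blinfun_apply \<mu> ?h = real (card F) * \<alpha>"
          using \<mu> unfolding left_invariant_mean_def by (simp add: blinfun.sum_right)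
        moreover have "blinfun_apply \<mu> (const_bcontfun (real (card F) - 1)) = real (card F) - 1"
          by (rule pre_mean_const[OF pm])
        ultimately show False
          using \<alpha>(2) cF by (simp add: field_simps)
      qed
    qed
  qed
qed

section \<open>Almost invariant finite sets\<close>

lemma card_notin_le:
  assumes "finite K"
  shows "card {k\<in>K. f k \<notin> B} \<le> card (K - f ` K) + card (K - B)"
proof -
  have "card (K \<inter> f ` K \<inter> B) \<le> card (f ` {k\<in>K. f k \<in> B})"
    using assms by (intro card_mono) auto
  also have "\<dots> \<le> card {k\<in>K. f k \<in> B}"
    using assms by (intro card_image_le) auto
  finally have 1: "card (K \<inter> f ` K \<inter> B) \<le> card {k\<in>K. f k \<in> B}" .
  have "K = {k\<in>K. f k \<in> B} \<union> {k\<in>K. f k \<notin> B}"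
    by auto
  then have 2: "card K = card {k\<in>K. f k \<in> B} + card {k\<in>K. f k \<notin> B}"
    using assms by (metis (no_types, lifting) card_Un_disjoint disjoint_iff finite_Un mem_Collect_eq)
  have "card K \<le> card ((K - f ` K) \<union> (K - B) \<union> (K \<inter> f ` K \<inter> B))"
    using assms by (intro card_mono) auto
  also have "\<dots> \<le> card (K - f ` K) + card (K - B) + card (K \<inter> f ` K \<inter> B)"
    by (metis (no_types, lifting) card_Un_le le_trans add_le_mono1)
  finally show ?thesis
    using 1 2 by linarith
qed

text \<open>Union bound: the bad sets together are too small to cover \<open>K\<close>.\<close>

lemma ex_avoiding_bad:
  assumes "finite K" "finite I" "(\<Sum>i\<in>I. card {k\<in>K. \<not> P i k}) < card K"
  obtains k where "k \<in> K" "\<And>i. i \<in> I \<Longrightarrow> P i k"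
proof -
  have "card (\<Union>i\<in>I. {k\<in>K. \<not> P i k}) < card K"
    using card_UN_le[OF assms(2), of "\<lambda>i. {k\<in>K. \<not> P i k}"] assms(3) by linarith
  moreover have "finite (\<Union>i\<in>I. {k\<in>K. \<not> P i k})"
    using assms by auto
  ultimately have "\<not> K \<subseteq> (\<Union>i\<in>I. {k\<in>K. \<not> P i k})"
    by (meson card_mono leD)
  then show ?thesis
    using that by blast
qed

lemma ex_pair_avoiding_bad:
  assumes "finite K" "card {k\<in>K. \<not> P k} + card {k\<in>K. \<not> Q k} < card K"
  obtains k where "k \<in> K" "P k" "Q k"
proof (rule ex_avoiding_bad[of K "UNIV :: bool set" "\<lambda>b. if b then P else Q"])
  fix k
  assume "k \<in> K" and "\<And>b. b \<in> UNIV \<Longrightarrow> (if b then P else Q) k"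
  from this(1) this(2)[of True] this(2)[of False] show thesis
    by (auto intro: that)
qed (use assms in \<open>auto simp: UNIV_bool\<close>)

section \<open>Left reversibility and cancellation up to a right multiple\<close>

text \<open>The images of \<open>K\<close> under \<open>a\<close> and \<open>b\<close> each miss
  less than half of \<open>K\<close>, so they meet.\<close>

lemma Folner_left_reversible:
  fixes a b :: "'a::semigroup_mult"
  assumes "strong_Folner TYPE('a)"
  obtains p q where "a * p = b * q"
proof -
  obtain K where K: "finite K" "K \<noteq> {}" "almost_invariant {a, b} (1/2) K"
    using assms unfolding strong_Folner_def by (metis finite.emptyI finite_insert half_gt_zero_iff insert_not_empty zero_less_one)
  obtain k where "k \<in> (*) a ` K" "k \<in> (*) b ` K"
  proof (rule ex_pair_avoiding_bad[OF K(1), of "\<lambda>k. k \<in> (*) a ` K" "\<lambda>k. k \<in> (*) b ` K"])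
    show "card {k\<in>K. k \<notin> (*) a ` K} + card {k\<in>K. k \<notin> (*) b ` K} < card K"
      using K(3) unfolding almost_invariant_def set_diff_eq by auto
  qed
  then show ?thesis
    using that by auto
qed

text \<open>Left cancellation holds modulo the relation \<open>\<exists>z. a * z = b * z\<close>: almost all of an almost
  invariant set is a set on which \<open>s\<close> is injective, and most \<open>k\<close> are carried into it by both
  \<open>a\<close> and \<open>b\<close>.\<close>

lemma Folner_cancel:
  fixes s a b :: "'a::semigroup_mult"
  assumes "strong_Folner TYPE('a)" "s * a = s * b"
  obtains z where "a * z = b * z"
proof -
  have "\<exists>K. finite K \<and> K \<noteq> {} \<and> almost_invariant {s, a, b} (1/4) K"
    using assms(1) unfolding strong_Folner_def by simp
  then obtain K where K: "finite K" "K \<noteq> {}" "almost_invariant {s, a, b} (1/4) K"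
    by blast
  \<comment> \<open>One preimage is chosen for each value of \<open>s\<close> on \<open>K\<close>:
    \<open>s\<close> is injective on \<open>R\<close>, and \<open>R\<close> has as many elements as
    the image of \<open>K\<close>.\<close>
  define R where "R = inv_into K ((*) s) ` ((*) s ` K)"
  have R: "R \<subseteq> K"
    unfolding R_def by (auto intro: inv_into_into)
  have inj: "inj_on ((*) s) R"
    unfolding R_def by (rule inj_onI) (auto simp: f_inv_into_f)
  have "card R = card ((*) s ` K)"
    unfolding R_def by (intro card_image inj_on_inv_into) auto
  then have "card (K - R) = card K - card ((*) s ` K)"
    using R K by (simp add: card_Diff_subset finite_subset)
  also have "\<dots> \<le> card (K - (*) s ` K)"
    using K by (intro diff_card_le_card_Diff) auto
  finally have "card (K - R) \<le> card (K - (*) s ` K)" .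
  then have KR: "4 * card (K - R) < card K"
    using K(3) unfolding almost_invariant_def by auto
  have ab: "4 * card (K - (*) a ` K) < card K" "4 * card (K - (*) b ` K) < card K"
    using K(3) unfolding almost_invariant_def by auto
  \<comment> \<open>For each of \<open>a\<close> and \<open>b\<close> fewer than half of the
    \<open>k\<close> fail: under a quarter from almost invariance and under a quarter from
    \<open>K - R\<close>.\<close>
  obtain k where k: "k \<in> K" "a * k \<in> R" "b * k \<in> R"
    using ex_pair_avoiding_bad[OF K(1), of "\<lambda>k. a * k \<in> R" "\<lambda>k. b * k \<in> R"]
      card_notin_le[OF K(1), of "(*) a" R] card_notin_le[OF K(1), of "(*) b" R] KR ab by auto
  have "s * (a * k) = s * (b * k)"
    using assms(2) by (metis mult.assoc)
  then show ?thesis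
    using inj k that unfolding inj_on_def by blast
qed

text \<open>Right multiples of an equalizer are equalizers, and left reversibility supplies a common
  right multiple \<open>z * p = w * q\<close> of two of them.\<close>

lemma Folner_common_equalizer:
  fixes P :: "('a::semigroup_mult \<times> 'a) set"
  assumes "strong_Folner TYPE('a)" "finite P" "\<And>a b. (a, b) \<in> P \<Longrightarrow> \<exists>z. a * z = b * z"
  obtains z where "\<And>a b. (a, b) \<in> P \<Longrightarrow> a * z = b * z"
proof -
  from assms(2,3) have "\<exists>z. \<forall>(a, b)\<in>P. a * z = b * z"
  proof (induction P rule: finite_induct)
    case (insert ab P)
    obtain a b where ab: "ab = (a, b)"
      by fastforce
    obtain z where z: "\<forall>(a, b)\<in>P. a * z = b * z"
      using insert by auto
    obtain w where w: "a * w = b * w"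
      using insert.prems ab by auto
    obtain p q where pq: "z * p = w * q"
      using Folner_left_reversible[OF assms(1)] by blast
    have "c * (z * p) = d * (z * p)" if "(c, d) \<in> P" for c d
    proof -
      have "c * z = d * z"
        using z that by auto
      then show ?thesis
        by (simp flip: mult.assoc)
    qed
    moreover have "a * (z * p) = b * (z * p)"
      using w unfolding pq by (simp flip: mult.assoc)
    ultimately have "\<forall>(c, d)\<in>insert ab P. c * (z * p) = d * (z * p)"
      using ab by auto
    then show ?case
      by blast
  qed auto
  then show ?thesis
    using that by blast
qed

text \<open>First \<open>z\<close> merges all pairs of \<open>K\<close> that some right factor
  merges, then thickness moves the result into \<open>A\<close> by \<open>x\<close>. Any pair
  identified by \<open>s\<close> after translation by \<open>v = z * x\<close> is such a pair by
  \<open>Folner_cancel\<close>, hence was already merged.\<close>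

lemma Folner_thick_translate:
  fixes A :: "'a::semigroup_mult set"
  assumes "strong_Folner TYPE('a)" "thick A" "finite K" "K \<noteq> {}"
  obtains v where "(\<lambda>k. k * v) ` K \<subseteq> A" "\<And>s. inj_on ((*) s) ((\<lambda>k. k * v) ` K)"
proof -
  define E where "E = {(a, b)\<in>K \<times> K. \<exists>z. a * z = b * z}"
  have "finite E"
    by (rule finite_subset[of _ "K \<times> K"]) (use assms(3) in \<open>auto simp: E_def\<close>)
  then obtain z where z: "\<And>a b. (a, b) \<in> E \<Longrightarrow> a * z = b * z"
    by (rule Folner_common_equalizer[OF assms(1)]) (auto simp: E_def)
  obtain x where x: "(\<lambda>y. y * x) ` ((\<lambda>k. k * z) ` K) \<subseteq> A"
    using assms unfolding thick_def by blast
  show ?thesis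
  proof
    show "(\<lambda>k. k * (z * x)) ` K \<subseteq> A"
      using x by (simp add: image_image mult.assoc)
  next
    fix s
    show "inj_on ((*) s) ((\<lambda>k. k * (z * x)) ` K)"
    proof (rule inj_onI, clarify)
      fix a b
      assume ab: "a \<in> K" "b \<in> K" and "s * (a * (z * x)) = s * (b * (z * x))"
      then obtain w where "(a * (z * x)) * w = (b * (z * x)) * w"
        using Folner_cancel[OF assms(1)] by blast
      then have "a * ((z * x) * w) = b * ((z * x) * w)"
        by (simp add: mult.assoc)
      then have "a * z = b * z"
        using z[of a b] ab unfolding E_def by blast
      then show "a * (z * x) = b * (z * x)"
        by (simp flip: mult.assoc)
    qed
  qed
qed

section \<open>Level sets of fibre sizes\<close>

definition fibre_level :: "'a set \<Rightarrow> ('a \<Rightarrow> 'b) \<Rightarrow> nat \<Rightarrow> 'b set" where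
  "fibre_level K p j = {y \<in> p ` K. j \<le> card {k\<in>K. p k = y}}"

lemma sum_card_fibres:
  assumes "finite K" "M \<subseteq> K"
  shows "(\<Sum>y\<in>p ` K. card {m\<in>M. p m = y}) = card M"
proof -
  have "(\<Sum>y\<in>p ` K. card {m\<in>M. p m = y}) = (\<Sum>y\<in>p ` K. \<Sum>m\<in>{m\<in>M. p m = y}. 1)"
    by simp
  also have "\<dots> = (\<Sum>m\<in>M. 1)"
    using assms by (intro sum.group) (auto intro: finite_subset)
  finally show ?thesis
    by simp
qed

text \<open>Layer-cake count: a point whose fibre has \<open>n\<close> elements lies in exactly the
  levels 1 to \<open>n\<close>.\<close>

lemma sum_card_fibre_level:
  assumes "finite K"
  shows "(\<Sum>j=1..card K. card (fibre_level K p j)) = card K"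
proof -
  have "(\<Sum>j=1..card K. card (fibre_level K p j)) = (\<Sum>y\<in>p ` K. card {k\<in>K. p k = y})"
    unfolding fibre_level_def
  proof (rule sum_multicount_gen; safe?)
    fix y
    have "card {k\<in>K. p k = y} \<le> card K"
      using assms by (intro card_mono) auto
    then have "{j\<in>{1..card K}. j \<le> card {k\<in>K. p k = y}} = {1..card {k\<in>K. p k = y}}"
      by auto
    then show "card {j\<in>{1..card K}. j \<le> card {k\<in>K. p k = y}} = card {k\<in>K. p k = y}"
      by simp
  qed (use assms in auto)
  then show ?thesis
    using sum_card_fibres[OF assms subset_refl] by simp
qed

text \<open>Here \<open>\<sigma>\<close> lifts \<open>\<tau>\<close> along \<open>p\<close>. The
  count is done separately over each \<open>y\<close>: the levels containing \<open>y\<close> but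
  not reaching it through \<open>\<tau>\<close> are at most as many as the elements of the fibre
  over \<open>y\<close> that \<open>\<sigma>\<close> misses.\<close>

lemma sum_card_fibre_level_Diff_le:
  assumes "finite K" "\<And>k. k \<in> K \<Longrightarrow> p (\<sigma> k) = \<tau> (p k)" "inj_on \<tau> (p ` K)"
  shows "(\<Sum>j=1..card K. card (fibre_level K p j - \<tau> ` fibre_level K p j)) \<le> card (K - \<sigma> ` K)"
proof -
  let ?N = "\<lambda>y. {j\<in>{1..card K}. j \<le> card {k\<in>K. p k = y} \<and> y \<notin> \<tau> ` fibre_level K p j}"
  have "(\<Sum>j=1..card K. card {y\<in>p ` K. j \<le> card {k\<in>K. p k = y} \<and> y \<notin> \<tau> ` fibre_level K p j})
      = (\<Sum>y\<in>p ` K. card (?N y))"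
    by (rule sum_multicount_gen) (use assms in auto)
  moreover have "fibre_level K p j - \<tau> ` fibre_level K p j =
      {y\<in>p ` K. j \<le> card {k\<in>K. p k = y} \<and> y \<notin> \<tau> ` fibre_level K p j}" for j
    unfolding fibre_level_def by blast
  ultimately have "(\<Sum>j=1..card K. card (fibre_level K p j - \<tau> ` fibre_level K p j))
      = (\<Sum>y\<in>p ` K. card (?N y))"
    by simp
  also have "\<dots> \<le> (\<Sum>y\<in>p ` K. card {m\<in>K - \<sigma> ` K. p m = y})"
  proof (rule sum_mono)
    fix y
    let ?U = "{k\<in>K. p k = y}" and ?V = "{m\<in>\<sigma> ` K. p m = y}"
    have "y \<in> \<tau> ` fibre_level K p j" if j: "1 \<le> j" "j \<le> card ?V" for j
    proof -
      obtain k where k: "k \<in> K" "p (\<sigma> k) = y"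
        using j by (metis (mono_tags, lifting) card.empty Collect_empty_eq image_iff not_one_le_zero order_trans)
      \<comment> \<open>Injectivity of \<open>\<tau>\<close> forces everything in \<open>?V\<close>
        to come from the single fibre over \<open>p k\<close>, which therefore has at least
        \<open>card ?V\<close> elements.\<close>
      have "?V \<subseteq> \<sigma> ` {m\<in>K. p m = p k}"
        using k assms(2,3) unfolding inj_on_def by fastforce
      then have "card ?V \<le> card {m\<in>K. p m = p k}"
        using assms(1) by (intro surj_card_le) auto
      then have "p k \<in> fibre_level K p j"
        using k j unfolding fibre_level_def by auto
      then show ?thesis
        using k assms(2) by force
    qed
    then have "?N y \<subseteq> {card ?V<..card ?U}"
      by (auto simp: not_le[symmetric])
    then have "card (?N y) \<le> card ?U - card ?V"
      using card_mono[of "{card ?V<..card ?U}" "?N y"] by simp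
    also have "\<dots> \<le> card (?U - ?V)"
      using assms(1) by (intro diff_card_le_card_Diff) auto
    also have "?U - ?V = {m\<in>K - \<sigma> ` K. p m = y}"
      by auto
    finally show "card (?N y) \<le> card {m\<in>K - \<sigma> ` K. p m = y}" .
  qed
  also have "\<dots> = card (K - \<sigma> ` K)"
    using assms(1) by (intro sum_card_fibres) auto
  finally show ?thesis .
qed

text \<open>The translate \<open>Kv\<close> may lose almost invariance because \<open>k \<mapsto> kv\<close> has fibres of different
  sizes; averaging over the level sets of the fibre size recovers an almost invariant subset.\<close>

lemma thick_imp_almost_invariant_subset:
  fixes A H :: "'a::semigroup_mult set"
  assumes "strong_Folner TYPE('a)" "thick A" "finite H" "H \<noteq> {}" "\<epsilon> > 0"
  obtains K where "finite K" "K \<noteq> {}" "almost_invariant H \<epsilon> K" "K \<subseteq> A"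
proof -
  \<comment> \<open>One level must serve all \<open>s \<in> H\<close> at once, so the defects are
    summed over \<open>H\<close>; dividing by \<open>card H\<close> keeps their total below
    \<open>\<epsilon> * card K\<close>.\<close>
  define \<delta> where "\<delta> = \<epsilon> / real (card H)"
  have cH: "card H > 0"
    using assms by auto
  then have "\<delta> > 0"
    unfolding \<delta>_def using assms by simp
  then obtain K where K: "finite K" "K \<noteq> {}" "almost_invariant H \<delta> K"
    using assms unfolding strong_Folner_def by blast
  obtain v where v: "(\<lambda>k. k * v) ` K \<subseteq> A" "\<And>s. inj_on ((*) s) ((\<lambda>k. k * v) ` K)"
    using Folner_thick_translate[OF assms(1,2) K(1,2)] by blast
  define L where "L = fibre_level K (\<lambda>k. k * v)"
  have LK: "L j \<subseteq> (\<lambda>k. k * v) ` K" for j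
    unfolding L_def fibre_level_def by blast
  then have fL: "finite (L j)" for j
    using K(1) finite_subset by blast
  have "(\<Sum>j=1..card K. card (L j - (*) s ` L j)) \<le> card (K - (*) s ` K)" for s
    unfolding L_def by (rule sum_card_fibre_level_Diff_le) (use K v in \<open>auto simp: mult.assoc\<close>)
  then have "(\<Sum>j=1..card K. real (card (L j - (*) s ` L j))) \<le> real (card (K - (*) s ` K))" for s
    by (simp flip: of_nat_sum)
  moreover have "real (card (K - (*) s ` K)) < \<delta> * real (card K)" if "s \<in> H" for s
    using K(3) that unfolding almost_invariant_def by blast
  ultimately have L_s: "(\<Sum>j=1..card K. real (card (L j - (*) s ` L j))) < \<delta> * real (card K)"
    if "s \<in> H" for s
    using that order_le_less_trans by blast
  have "(\<Sum>j=1..card K. \<Sum>s\<in>H. real (card (L j - (*) s ` L j)))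
      = (\<Sum>s\<in>H. \<Sum>j=1..card K. real (card (L j - (*) s ` L j)))"
    by (rule sum.swap)
  also have "\<dots> < (\<Sum>s\<in>H. \<delta> * real (card K))"
    using assms L_s by (intro sum_strict_mono) auto
  also have "\<dots> = \<epsilon> * real (card K)"
    using cH by (simp add: \<delta>_def)
  also have "\<dots> = (\<Sum>j=1..card K. \<epsilon> * real (card (L j)))"
    using sum_card_fibre_level[OF K(1), of "\<lambda>k. k * v"] unfolding L_def
    by (simp flip: of_nat_sum sum_distrib_left)
  \<comment> \<open>If every level failed this inequality, summing over the levels would contradict
    the strict bound. Strictness also makes \<open>L j\<close> nonempty.\<close>
  finally obtain j where j: "(\<Sum>s\<in>H. real (card (L j - (*) s ` L j))) < \<epsilon> * real (card (L j))"
    by (meson sum_mono not_le)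
  have "almost_invariant H \<epsilon> (L j)"
    unfolding almost_invariant_def
  proof
    fix s
    assume "s \<in> H"
    then have "real (card (L j - (*) s ` L j)) \<le> (\<Sum>s\<in>H. real (card (L j - (*) s ` L j)))"
      using assms by (intro member_le_sum) auto
    then show "real (card (L j - (*) s ` L j)) < \<epsilon> * real (card (L j))"
      using j by linarith
  qed
  moreover have "L j \<noteq> {}"
    using j by auto
  moreover have "L j \<subseteq> A"
    using LK v(1) by (rule subset_trans)
  ultimately show ?thesis
    using fL by (intro that)
qed

section \<open>Thickness and the Folner density\<close>

lemma d_Folner_eq_one_iff:
  fixes A :: "'a::semigroup_mult set"
  assumes "strong_Folner TYPE('a)"
  shows "d_Folner A = 1 \<longleftrightarrow> thick A"
proof -
  define D where "D = {\<alpha>\<in>{0..1}. \<forall>H. \<forall>\<epsilon>>0. finite H \<and> H \<noteq> {} \<longrightarrow>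
     (\<exists>K. finite K \<and> K \<noteq> {} \<and> almost_invariant H \<epsilon> K \<and>
        real (card (A \<inter> K)) \<ge> \<alpha> * real (card K))}"
  have d: "d_Folner A = Sup D"
    unfolding d_Folner_def D_def ..
  show ?thesis
  proof
    assume thick: "thick A"
    have "\<exists>K. finite K \<and> K \<noteq> {} \<and> almost_invariant H \<epsilon> K \<and> real (card (A \<inter> K)) \<ge> 1 * real (card K)"
      if "\<epsilon> > 0" "finite H \<and> H \<noteq> {}" for H \<epsilon>
    proof -
      from that have "finite H" "H \<noteq> {}"
        by auto
      then obtain K where "finite K" "K \<noteq> {}" "almost_invariant H \<epsilon> K" "K \<subseteq> A"
        by (rule thick_imp_almost_invariant_subset[OF assms thick _ _ \<open>\<epsilon> > 0\<close>])
      then show ?thesis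
        by (intro exI[of _ K]) (auto simp: Int_absorb1)
    qed
    then have "1 \<in> D"
      unfolding D_def by auto
    then show "d_Folner A = 1"
      unfolding d by (intro Sup_unit_eq_one) (auto simp: D_def)
  next
    assume 1: "d_Folner A = 1"
    \<comment> \<open>For the value 0 the defining condition is the Strong Folner Condition
      itself.\<close>
    have "0 \<in> D"
      using assms unfolding D_def strong_Folner_def by simp
    moreover have "bdd_above D"
      unfolding D_def by (auto intro!: bdd_aboveI[of _ 1])
    ultimately have ne: "D \<noteq> {}" "bdd_above D"
      by auto
    show "thick A"
      unfolding thick_def
    proof (intro allI impI)
      fix F :: "'a set"
      assume F: "finite F \<and> F \<noteq> {}"
      \<comment> \<open>The factor 2 pays for two losses for each \<open>t\<close>, the points of
        \<open>K\<close> outside its image under \<open>t\<close> and those outside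
        \<open>A\<close>; the bad proportion stays below \<open>1 / card F\<close>.\<close>
      define \<delta> where "\<delta> = 1 / (2 * real (card F))"
      have cF: "card F > 0"
        using F by auto
      then have \<delta>: "\<delta> > 0"
        unfolding \<delta>_def by simp
      obtain \<alpha> where \<alpha>: "\<alpha> \<in> D" "1 - \<delta> < \<alpha>"
        using Sup_eq_one_approx[OF 1[unfolded d] ne \<delta>] by blast
      then obtain K where K: "finite K" "K \<noteq> {}" "almost_invariant F \<delta> K"
        "real (card (A \<inter> K)) \<ge> \<alpha> * real (card K)"
        using F \<delta> unfolding D_def by blast
      have cK: "card K > 0"
        using K by auto
      have "card K = card (A \<inter> K) + card (K - A)"
        using K(1) by (metis card_Int_Diff Int_commute)
      moreover have "(1 - \<delta>) * real (card K) < \<alpha> * real (card K)"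
        using \<alpha>(2) cK by simp
      ultimately have KA: "real (card (K - A)) < \<delta> * real (card K)"
        using K(4) by (simp add: algebra_simps)
      have "real (card {k\<in>K. t * k \<notin> A}) < 2 * \<delta> * real (card K)" if "t \<in> F" for t
      proof -
        have "real (card (K - (*) t ` K)) < \<delta> * real (card K)"
          using K(3) that unfolding almost_invariant_def by blast
        then show ?thesis
          using card_notin_le[OF K(1), of "(*) t" A] KA by linarith
      qed
      then have "(\<Sum>t\<in>F. real (card {k\<in>K. t * k \<notin> A})) < (\<Sum>t\<in>F. 2 * \<delta> * real (card K))"
        using F by (intro sum_strict_mono) auto
      also have "\<dots> = real (card K)"
        using cF by (simp add: \<delta>_def)
      finally have "(\<Sum>t\<in>F. card {k\<in>K. t * k \<notin> A}) < card K"
        by (simp flip: of_nat_sum)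
      then obtain k where "\<And>t. t \<in> F \<Longrightarrow> t * k \<in> A"
        using ex_avoiding_bad[of K F "\<lambda>t k. t * k \<in> A"] K(1) F by blast
      then show "\<exists>x. (\<lambda>y. y * x) ` F \<subseteq> A"
        by blast
    qed
  qed
qed

theorem theorem2p10:
  fixes A :: "'a::semigroup_mult set"
  shows "(d_t A = 1 \<longleftrightarrow> thick A) \<and>
    (left_amenable TYPE('a) \<longrightarrow> (d_star A = 1 \<longleftrightarrow> thick A)) \<and>
    (strong_Folner TYPE('a) \<longrightarrow> (d_Folner A = 1 \<longleftrightarrow> thick A))"
  using d_t_eq_one_iff d_star_eq_one_iff d_Folner_eq_one_iff by blast

end
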